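(* For any distance space $(X,d)$, $\mathsf{Cob}^\omega(X,d)$ is a completely metrizable space that is connected if and only if $(X,d)$ is connected, and its separablewise components are singletons.
   Context: A distance space is a pair $(X,d)$ where $d\colon X\times X\to[0,\infty)$ is any function with $d(x,x)=0$ for all $x\in X$ (no symmetry or triangle inequality is assumed). Put $B_d(x,r)=\{z\in X: d(x,z)<r\}$. The topology of $(X,d)$: a set $E\subset X$ is open iff for every $x\in E$ there is $r>0$ with $B_d(x,r)\subset E$. Complete oriented graph. For a set $X$ and distinct $x,y\in X$ the oriented edge is $[x,y]=\{x,y\}\cup\{(x,y,t): t\in(0,1)\}$, where the points $(x,y,t)$ are pairwise distinct for distinct triples and do not belong to $X$; thus $[x,y]\cap[y,x]=\{x,y\}$. Let $\Gamma(X)=X\cup\bigcup\{[x,y]: x,y\in X,\ x\ne y\}$. On pairs of points of a common edge define, for distinct $x,y\in X$ and $t,s\in(0,1)$: $r(x,x)=0$, $r(x,y)=1$, $r((x,y,t),(x,y,s))=|t-s|$, $r(x,(x,y,t))=r((x,y,t),x)=t$, $r(y,(x,y,t))=r((x,y,t),y)=1-t$. For $a,b\in\Gamma(X)$ let $\rho(a,b)$ be the infimum of $\sum_{i=1}^n r(a_i,a_{i-1})$ over all finite sequences $a=a_0,a_1,\dots,a_n=b$ in $\Gamma(X)$ such that any two consecutive points lie on a common edge (with $\rho(a,a)=0$). Then $\rho$ is a metric on $\Gamma(X)$ and each edge is isometric to $[0,1]$. Cobweb. Let $(X,d)$ be a distance space and $d_1=\min\{d,1/2\}$. For distinct $a,b\in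 X$ let $a_b\in[a,b]$ be the unique point with $\rho(a_b,b)=d_1(b,a)$, and let $[a,a_b]=\{z\in[a,b]:\rho(a,z)\le 1-d_1(b,a)\}$. Let $Z_a=\{a\}\cup\bigcup\{[a,a_b]\setminus\{b\}: b\in X\setminus\{a\}\}$. The cobweb over $(X,d)$ is $\mathsf{Cob}(X,d)=\bigcup_{a\in X}Z_a\subset\Gamma(X)$ with the metric $\rho$ restricted from $\Gamma(X)$. The sets $Z_a$ are pairwise disjoint, and the compression map $\pi\colon\mathsf{Cob}(X,d)\to X$ is defined by $\pi(Z_a)=\{a\}$ for all $a\in X$. Iterated cobwebs. Let $\mathsf{Cob}^1(X,d)=\mathsf{Cob}(X,d)$ with its cobweb metric $\rho_1$ (the restriction of the metric of $\Gamma(X)$), and inductively $\mathsf{Cob}^{n+1}(X,d)=\mathsf{Cob}(\mathsf{Cob}^n(X,d),\rho_n)$ with its cobweb metric $\rho_{n+1}$ (the restriction of the metric of $\Gamma(\mathsf{Cob}^n(X,d))$). Let $\pi^{n+1}_n\colon\mathsf{Cob}^{n+1}(X,d)\to\mathsf{Cob}^n(X,d)$ be the compression maps. Then $\mathsf{Cob}^\omega(X,d)=\{(x_n)_{n=1}^\infty\in\prod_{n\in\mathbb N}\mathsf{Cob}^n(X,d):\pi^{n+1}_n(x_{n+1})=x_n\text{ for all }n\in\mathbb N\}$ is the inverse limit, with the subspace topology of the product topology. The separablewise component of a point $x_0$ of a topological space is the union of all separable connected subsets containing $x_0$. *)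

theory Defs
  imports "HOL-Analysis.Analysis"
begin

section \<open>Distance spaces\<close>

locale distance_space =
  fixes X :: "'a set" and d :: "'a \<Rightarrow> 'a \<Rightarrow> real"
  assumes nonneg: "\<And>x y. \<lbrakk>x \<in> X; y \<in> X\<rbrakk> \<Longrightarrow> 0 \<le> d x y"
    and refl_zero: "\<And>x. x \<in> X \<Longrightarrow> d x x = 0"

definition dball :: "'a set \<Rightarrow> ('a \<Rightarrow> 'a \<Rightarrow> real) \<Rightarrow> 'a \<Rightarrow> real \<Rightarrow> 'a set" where
  "dball X d x r = {z \<in> X. d x z < r}"

definition distance_open :: "'a set \<Rightarrow> ('a \<Rightarrow> 'a \<Rightarrow> real) \<Rightarrow> 'a set \<Rightarrow> bool" where
  "distance_open X d E \<longleftrightarrow> E \<subseteq> X \<and> (\<forall>x\<in>E. \<exists>r>0. dball X d x r \<subseteq> E)"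

definition distance_topology :: "'a set \<Rightarrow> ('a \<Rightarrow> 'a \<Rightarrow> real) \<Rightarrow> 'a topology" where
  "distance_topology X d = topology (distance_open X d)"

lemma istopology_distance_open: "istopology (distance_open X d)"
  unfolding istopology_def
proof (intro conjI allI impI)
  fix S T assume S: "distance_open X d S" and T: "distance_open X d T"
  have "\<exists>r>0. dball X d x r \<subseteq> S \<inter> T" if x: "x \<in> S \<inter> T" for x
  proof -
    obtain p q where "p > 0" "dball X d x p \<subseteq> S" "q > 0" "dball X d x q \<subseteq> T"
      using S T x unfolding distance_open_def by blast
    then show ?thesis
      by (intro exI[of _ "min p q"]) (auto simp: dball_def)
  qed
  then show "distance_open X d (S \<inter> T)"
    using S T unfolding distance_open_def by blast
next
  fix \<K> assume "\<forall>K\<in>\<K>. distance_open X d K"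
  then show "distance_open X d (\<Union>\<K>)"
    unfolding distance_open_def by (meson Sup_least Sup_upper2 UnionE)
qed

lemma openin_distance_topology: "openin (distance_topology X d) E \<longleftrightarrow> distance_open X d E"
  by (simp add: distance_topology_def istopology_distance_open)

section \<open>The complete oriented graph\<close>

text \<open>
  All iterated cobwebs over a space with points in \<open>'a\<close> live in the single type \<open>'a pt\<close>.
  \<open>Base\<close> embeds the initial space.  For a set \<open>X\<close> of such points, \<open>Vert x\<close> is the copy of
  \<open>x \<in> X\<close> in \<open>\<Gamma>(X)\<close> and \<open>Inner x y t\<close> is the point \<open>(x, y, t)\<close> of \<open>\<Gamma>(X)\<close>.  The tag \<open>Vert\<close>
  is what makes the points \<open>(x, y, t)\<close> new even if \<open>X\<close> is itself a cobweb.
\<close>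

datatype 'a pt = Base (of_Base: 'a) | Vert "'a pt" | Inner "'a pt" "'a pt" real

definition edge :: "'a pt \<Rightarrow> 'a pt \<Rightarrow> 'a pt set" where
  "edge x y = {Vert x, Vert y} \<union> {Inner x y t |t. 0 < t \<and> t < 1}"

definition Gamma :: "'a pt set \<Rightarrow> 'a pt set" where
  "Gamma X = Vert ` X \<union> \<Union>{edge x y |x y. x \<in> X \<and> y \<in> X \<and> x \<noteq> y}"

definition on_common_edge :: "'a pt set \<Rightarrow> 'a pt \<Rightarrow> 'a pt \<Rightarrow> bool" where
  "on_common_edge X u v \<longleftrightarrow>
     (\<exists>x\<in>X. \<exists>y\<in>X. x \<noteq> y \<and> u \<in> edge x y \<and> v \<in> edge x y)"

text \<open>The function \<open>r\<close>; its values are only meaningful for pairs of points on a common edge.\<close>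

fun edge_dist :: "'a pt \<Rightarrow> 'a pt \<Rightarrow> real" where
  "edge_dist (Vert x) (Vert y) = (if x = y then 0 else 1)"
| "edge_dist (Inner x y t) (Inner x' y' s) = \<bar>t - s\<bar>"
| "edge_dist (Vert z) (Inner x y t) = (if z = x then t else 1 - t)"
| "edge_dist (Inner x y t) (Vert z) = (if z = x then t else 1 - t)"
| "edge_dist _ _ = 0"

definition is_chain :: "'a pt set \<Rightarrow> 'a pt \<Rightarrow> 'a pt \<Rightarrow> nat \<Rightarrow> (nat \<Rightarrow> 'a pt) \<Rightarrow> bool" where
  "is_chain X u v n a \<longleftrightarrow> a 0 = u \<and> a n = v \<and> (\<forall>i\<le>n. a i \<in> Gamma X) \<and>
     (\<forall>i\<in>{1..n}. on_common_edge X (a (i - 1)) (a i))"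

text \<open>The metric \<open>\<rho>\<close>. Its value outside \<open>\<Gamma>(X)\<close> is set to 0, because the locale
  \<^locale>\<open>Metric_space\<close> demands nonnegativity and symmetry on the whole type.\<close>

definition Gamma_dist :: "'a pt set \<Rightarrow> 'a pt \<Rightarrow> 'a pt \<Rightarrow> real" where
  "Gamma_dist X u v =
     (if u \<in> Gamma X \<and> v \<in> Gamma X \<and> u \<noteq> v
      then Inf {\<Sum>i=1..n. edge_dist (a i) (a (i - 1)) |n a. is_chain X u v n a}
      else 0)"

section \<open>Cobwebs\<close>

definition trunc_dist :: "('a \<Rightarrow> 'a \<Rightarrow> real) \<Rightarrow> 'a \<Rightarrow> 'a \<Rightarrow> real" where
  "trunc_dist d x y = min (d x y) (1/2)"

text \<open>The segment from \<open>a\<close> to the point \<open>a\<^sub>b\<close> of the edge from \<open>a\<close> to \<open>b\<close> that is at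
  distance \<open>d\<^sub>1(b, a)\<close> from \<open>b\<close>.\<close>

definition segment :: "'a pt set \<Rightarrow> ('a pt \<Rightarrow> 'a pt \<Rightarrow> real) \<Rightarrow> 'a pt \<Rightarrow> 'a pt \<Rightarrow> 'a pt set" where
  "segment X d a b = {z \<in> edge a b. Gamma_dist X (Vert a) z \<le> 1 - trunc_dist d b a}"

definition Zset :: "'a pt set \<Rightarrow> ('a pt \<Rightarrow> 'a pt \<Rightarrow> real) \<Rightarrow> 'a pt \<Rightarrow> 'a pt set" where
  "Zset X d a = {Vert a} \<union> (\<Union>b\<in>X - {a}. segment X d a b - {Vert b})"

definition Cob :: "'a pt set \<Rightarrow> ('a pt \<Rightarrow> 'a pt \<Rightarrow> real) \<Rightarrow> 'a pt set" where
  "Cob X d = (\<Union>a\<in>X. Zset X d a)"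

definition compression :: "'a pt set \<Rightarrow> ('a pt \<Rightarrow> 'a pt \<Rightarrow> real) \<Rightarrow> 'a pt \<Rightarrow> 'a pt" where
  "compression X d z = (THE a. a \<in> X \<and> z \<in> Zset X d a)"

section \<open>Iterated cobwebs and their inverse limit\<close>

text \<open>Stage 0 is the distance space \<open>(X, d)\<close> itself; stage \<open>n \<ge> 1\<close> is \<open>(Cob\<^sup>n(X, d), \<rho>\<^sub>n)\<close>.\<close>

primrec cob_stage ::
  "'a set \<Rightarrow> ('a \<Rightarrow> 'a \<Rightarrow> real) \<Rightarrow> nat \<Rightarrow> 'a pt set \<times> ('a pt \<Rightarrow> 'a pt \<Rightarrow> real)" where
  "cob_stage X d 0 = (Base ` X, \<lambda>u v. d (of_Base u) (of_Base v))"
| "cob_stage X d (Suc n) =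
     (case cob_stage X d n of (Y, e) \<Rightarrow> (Cob Y e, Gamma_dist Y))"

definition Cob_iter :: "'a set \<Rightarrow> ('a \<Rightarrow> 'a \<Rightarrow> real) \<Rightarrow> nat \<Rightarrow> 'a pt set" where
  "Cob_iter X d n = fst (cob_stage X d n)"

definition cob_metric :: "'a set \<Rightarrow> ('a \<Rightarrow> 'a \<Rightarrow> real) \<Rightarrow> nat \<Rightarrow> 'a pt \<Rightarrow> 'a pt \<Rightarrow> real" where
  "cob_metric X d n = snd (cob_stage X d n)"

definition cob_proj :: "'a set \<Rightarrow> ('a \<Rightarrow> 'a \<Rightarrow> real) \<Rightarrow> nat \<Rightarrow> 'a pt \<Rightarrow> 'a pt" where
  "cob_proj X d n = compression (Cob_iter X d n) (cob_metric X d n)"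

definition Cob_omega :: "'a set \<Rightarrow> ('a \<Rightarrow> 'a \<Rightarrow> real) \<Rightarrow> (nat \<Rightarrow> 'a pt) set" where
  "Cob_omega X d = {x \<in> Pi\<^sub>E {1..} (Cob_iter X d). \<forall>n\<ge>1. cob_proj X d n (x (n + 1)) = x n}"

definition Cob_omega_topology :: "'a set \<Rightarrow> ('a \<Rightarrow> 'a \<Rightarrow> real) \<Rightarrow> (nat \<Rightarrow> 'a pt) topology" where
  "Cob_omega_topology X d =
     subtopology
       (product_topology (\<lambda>n. Metric_space.mtopology (Cob_iter X d n) (cob_metric X d n)) {1..})
       (Cob_omega X d)"

section \<open>Separablewise components\<close>

definition separablewise_component_of :: "'a topology \<Rightarrow> 'a \<Rightarrow> 'a set" where
  "separablewise_component_of T x =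
     \<Union>{S. connectedin T S \<and> separable_space (subtopology T S) \<and> x \<in> S}"

end

theory Submission
  imports Defs
begin

text \<open>
  Write \<open>\<rho>\<close> for the path metric of \<open>\<Gamma>(Y)\<close>, \<open>foot\<close> for the map that sends every point of the star \<open>Z\<^sub>a\<close>
  to \<open>a\<close>, and call the preimage of a point under a projection of the inverse limit its fibre.

  \<^emph>\<open>The metric.\<close> Single edges bound \<open>\<rho>\<close> from above, and functions that are 1-Lipschitz on each
  edge bound it from below (\<open>Gamma_dist_ge_lipschitz\<close>). Two such functions, the distance to a vertex
  and the depth inside an edge, give the exact distances from the centre of a small ball, and show
  that such a ball is an interval or an open star. Everything later uses only this local picture.

  \<^emph>\<open>Complete metrizability.\<close> A cobweb is closed in the complete space \<open>\<Gamma>(Y)\<close>, and compression is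
  continuous, so the inverse limit is closed in a countable product of complete metric spaces.

  \<^emph>\<open>Separable connected sets are points.\<close> Over a metric space each ray of a cobweb ends before it
  reaches its target. A connected set that meets two stars must therefore contain
  the centre of every star that it meets. Centres are at mutual distance at least 1, so a
  separable set meets only countably many stars; but its image under \<open>foot\<close> is a connected
  subset of a metric space, and a countable one has at most one point
  (\<open>foot_constant_on_separable_connected\<close>). Hence a separable connected subset of the limit has
  only one point in each coordinate.

  \<^emph>\<open>Connectedness.\<close> The limit maps continuously onto the initial space. The converse needs care,
  because inverse limits of connected spaces can be disconnected, and the compression maps need
  not be open. Let \<open>U\<close> and \<open>V\<close> be disjoint open sets that cover the limit. The lemma that replaces
  openness is \<open>vertex_thread_avoids_open\<close>: if \<open>z\<close> is a limit of points whose fibres lie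
  in \<open>V\<close>, then the same is true of the vertex \<open>Vert z\<close> one stage higher, since the star of a point
  \<open>b\<close> close to \<open>z\<close> has a ray that almost reaches \<open>Vert z\<close>; so every neighbourhood of the thread
  \<open>z, Vert z, Vert (Vert z), \<dots>\<close> meets \<open>V\<close>, and the thread is not in \<open>U\<close>. As stars are connected, it
  follows that no fibre over the initial space is divided by \<open>U\<close> and \<open>V\<close> (\<open>fibre_not_divided\<close>), and
  then that the points with fibre in \<open>U\<close> and those with fibre in \<open>V\<close> form an open partition of the
  initial space.
\<close>

section \<open>The path metric of the complete oriented graph\<close>

lemma mem_edge [simp]:
  "Vert z \<in> edge x y \<longleftrightarrow> z = x \<or> z = y"
  "Inner a b t \<in> edge x y \<longleftrightarrow> a = x \<and> b = y \<and> 0 < t \<and> t < 1"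
  "Base c \<notin> edge x y"
  by (auto simp: edge_def)

lemma mem_Gamma [simp]:
  "Vert x \<in> Gamma Y \<longleftrightarrow> x \<in> Y"
  "Inner x y t \<in> Gamma Y \<longleftrightarrow> x \<in> Y \<and> y \<in> Y \<and> x \<noteq> y \<and> 0 < t \<and> t < 1"
  "Base c \<notin> Gamma Y"
  by (auto simp: Gamma_def) (metis mem_edge(2))

lemma GammaE:
  assumes "u \<in> Gamma Y"
  obtains (Vert) x where "u = Vert x" "x \<in> Y"
    | (Inner) x y t where "u = Inner x y t" "x \<in> Y" "y \<in> Y" "x \<noteq> y" "0 < t" "t < 1"
  using assms by (cases u) auto

lemma edge_dist_commute: "edge_dist u v = edge_dist v u"
  by (cases u; cases v) auto

lemma on_common_edge_commute: "on_common_edge Y u v \<longleftrightarrow> on_common_edge Y v u"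
  by (auto simp: on_common_edge_def)

lemma on_common_edge_in_Gamma:
  assumes "on_common_edge Y u v" shows "u \<in> Gamma Y" "v \<in> Gamma Y"
  using assms by (auto simp: on_common_edge_def Gamma_def)

lemma edge_dist_nonneg: "on_common_edge Y u v \<Longrightarrow> 0 \<le> edge_dist u v"
  by (cases u; cases v) (auto simp: on_common_edge_def)

text \<open>Finite chains with their lengths, generated one edge at a time; in this form they can be
  concatenated and reversed by induction.\<close>

inductive walk :: "'a pt set \<Rightarrow> 'a pt \<Rightarrow> 'a pt \<Rightarrow> real \<Rightarrow> bool" for Y where
  refl: "u \<in> Gamma Y \<Longrightarrow> walk Y u u 0"
| step: "\<lbrakk>walk Y u v l; on_common_edge Y v w\<rbrakk> \<Longrightarrow> walk Y u w (l + edge_dist w v)"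

lemma walk_in_Gamma: "walk Y u v l \<Longrightarrow> u \<in> Gamma Y \<and> v \<in> Gamma Y"
  by (induction rule: walk.induct) (auto dest: on_common_edge_in_Gamma)

lemma walk_nonneg: "walk Y u v l \<Longrightarrow> 0 \<le> l"
proof (induction rule: walk.induct)
  case (step u v l w)
  then show ?case using edge_dist_nonneg[of Y w v] by (simp add: on_common_edge_commute)
qed simp

lemma walk_edge: "on_common_edge Y u v \<Longrightarrow> walk Y u v (edge_dist u v)"
  using walk.step[OF walk.refl, of u Y v] on_common_edge_in_Gamma[of Y u v]
  by (simp add: edge_dist_commute)

lemma walk_trans: "walk Y v w m \<Longrightarrow> walk Y u v l \<Longrightarrow> walk Y u w (l + m)"
proof (induction rule: walk.induct)
  case (step v w m z)
  then show ?case using walk.step[of Y u w "l + m" z] by (simp add: add.assoc)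
qed simp

lemma walk_sym: "walk Y u v l \<Longrightarrow> walk Y v u l"
proof (induction rule: walk.induct)
  case (step u v l w)
  have "walk Y w v (edge_dist w v)"
    using step walk_edge on_common_edge_commute by blast
  from walk_trans[OF step.IH this] show ?case by (simp add: add.commute)
qed (rule walk.refl)

lemma walk_iff_chain:
  "walk Y u v l \<longleftrightarrow> (\<exists>n a. is_chain Y u v n a \<and> l = (\<Sum>i=1..n. edge_dist (a i) (a (i - 1))))"
proof
  assume "walk Y u v l"
  then show "\<exists>n a. is_chain Y u v n a \<and> l = (\<Sum>i=1..n. edge_dist (a i) (a (i - 1)))"
  proof (induction rule: walk.induct)
    case (refl u)
    then have "is_chain Y u u 0 (\<lambda>_. u)" by (simp add: is_chain_def)
    then show ?case by fastforce
  next
    case (step u v l w)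
    then obtain n a where a: "is_chain Y u v n a"
      and l: "l = (\<Sum>i=1..n. edge_dist (a i) (a (i - 1)))" by blast
    let ?b = "a(Suc n := w)"
    have "is_chain Y u w (Suc n) ?b"
      using a step.hyps(2) on_common_edge_in_Gamma[OF step.hyps(2)]
      by (auto simp: is_chain_def le_Suc_eq)
    moreover have "(\<Sum>i=1..n. edge_dist (?b i) (?b (i - 1))) = l"
      unfolding l by (intro sum.cong) auto
    then have "(\<Sum>i=1..Suc n. edge_dist (?b i) (?b (i - 1))) = l + edge_dist w v"
      using a by (simp add: is_chain_def)
    ultimately show ?case by metis
  qed
next
  have "walk Y u v (\<Sum>i=1..n. edge_dist (a i) (a (i - 1)))" if "is_chain Y u v n a" for n a v
    using that
  proof (induction n arbitrary: v)
    case 0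
    then show ?case by (auto simp: is_chain_def intro: walk.refl)
  next
    case (Suc n)
    then have "is_chain Y u (a n) n a" by (auto simp: is_chain_def)
    then have "walk Y u (a n) (\<Sum>i=1..n. edge_dist (a i) (a (i - 1)))" by (rule Suc.IH)
    moreover have "on_common_edge Y (a n) v"
      using Suc.prems by (force simp: is_chain_def)
    ultimately show ?case
      using walk.step Suc.prems by (fastforce simp: is_chain_def)
  qed
  then show "\<exists>n a. is_chain Y u v n a \<and> l = (\<Sum>i=1..n. edge_dist (a i) (a (i - 1))) \<Longrightarrow> walk Y u v l"
    by blast
qed

lemma Gamma_dist_walk:
  "u \<in> Gamma Y \<Longrightarrow> v \<in> Gamma Y \<Longrightarrow> u \<noteq> v \<Longrightarrow> Gamma_dist Y u v = Inf {l. walk Y u v l}"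
  unfolding Gamma_dist_def walk_iff_chain
  by (auto intro!: arg_cong[of _ _ Inf])

lemma Gamma_dist_refl [simp]: "Gamma_dist Y u u = 0"
  by (simp add: Gamma_dist_def)

text \<open>The infimum that defines \<open>\<rho>\<close> is taken over a nonempty set.\<close>

lemma Gamma_connected_by_walks:
  assumes u: "u \<in> Gamma Y" and v: "v \<in> Gamma Y" and "u \<noteq> v"
  shows "\<exists>l. walk Y u v l"
proof -
  have ex: "\<exists>x l. x \<in> Y \<and> walk Y u (Vert x) l" if "u \<in> Gamma Y" for u
    using that
  proof (cases rule: GammaE)
    case (Vert x)
    then show ?thesis using walk.refl by (metis that)
  next
    case (Inner x y t)
    then have "on_common_edge Y u (Vert x)" by (auto simp: on_common_edge_def)
    then show ?thesis using walk_edge Inner by blast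
  qed
  obtain x l where x: "x \<in> Y" "walk Y u (Vert x) l" using ex u by blast
  obtain y m where y: "y \<in> Y" "walk Y v (Vert y) m" using ex v by blast
  have "\<exists>k. walk Y (Vert x) (Vert y) k"
  proof (cases "x = y")
    case True
    then show ?thesis using walk.refl[of "Vert x" Y] x by auto
  next
    case False
    then have "on_common_edge Y (Vert x) (Vert y)" using x y by (auto simp: on_common_edge_def)
    then show ?thesis using walk_edge by blast
  qed
  then show ?thesis using x y walk_trans walk_sym by blast
qed

lemma Gamma_dist_le_walk:
  assumes "walk Y u v l" shows "Gamma_dist Y u v \<le> l"
proof (cases "u = v")
  case False
  have "bdd_below {l. walk Y u v l}" by (rule bdd_belowI[of _ 0]) (auto dest: walk_nonneg)
  then have "Inf {l. walk Y u v l} \<le> l" using assms by (intro cInf_lower) auto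
  then show ?thesis using False Gamma_dist_walk walk_in_Gamma[OF assms] by metis
qed (use assms walk_nonneg in auto)

lemma Gamma_dist_greatest:
  assumes "u \<in> Gamma Y" "v \<in> Gamma Y" "\<And>l. walk Y u v l \<Longrightarrow> c \<le> l"
  shows "c \<le> Gamma_dist Y u v"
proof (cases "u = v")
  case True
  then show ?thesis using assms(3)[of 0] walk.refl assms by auto
next
  case False
  then have "c \<le> Inf {l. walk Y u v l}"
    using assms Gamma_connected_by_walks[of u Y v] by (intro cInf_greatest) auto
  then show ?thesis using False Gamma_dist_walk assms by metis
qed

lemma Gamma_dist_le_edge: "on_common_edge Y u v \<Longrightarrow> Gamma_dist Y u v \<le> edge_dist u v"
  by (intro Gamma_dist_le_walk walk_edge)

lemma Gamma_dist_commute: "Gamma_dist Y u v = Gamma_dist Y v u"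
proof -
  have "walk Y u v = walk Y v u" using walk_sym by blast
  then show ?thesis
    using Gamma_dist_walk[of u Y v] Gamma_dist_walk[of v Y u]
    by (cases "u \<in> Gamma Y \<and> v \<in> Gamma Y \<and> u \<noteq> v") (auto simp: Gamma_dist_def)
qed

lemma Gamma_dist_nonneg: "0 \<le> Gamma_dist Y u v"
proof (cases "u \<in> Gamma Y \<and> v \<in> Gamma Y")
  case True
  then show ?thesis using Gamma_dist_greatest walk_nonneg by blast
qed (auto simp: Gamma_dist_def)

lemma Gamma_dist_triangle:
  assumes "u \<in> Gamma Y" "v \<in> Gamma Y" "w \<in> Gamma Y"
  shows "Gamma_dist Y u w \<le> Gamma_dist Y u v + Gamma_dist Y v w"
proof -
  have "Gamma_dist Y u w - m \<le> Gamma_dist Y u v" if "walk Y v w m" for m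
    using Gamma_dist_le_walk[OF walk_trans[OF that]] assms
    by (intro Gamma_dist_greatest) (force simp: diff_le_eq)+
  then have "Gamma_dist Y u w - Gamma_dist Y u v \<le> Gamma_dist Y v w"
    using assms by (intro Gamma_dist_greatest) (force simp: algebra_simps)+
  then show ?thesis by simp
qed

text \<open>Lower bounds for an infimum over all chains come from functions that are 1-Lipschitz
  along every edge: their increments telescope along a chain.\<close>

lemma Gamma_dist_ge_lipschitz:
  assumes g: "\<And>u v. on_common_edge Y u v \<Longrightarrow> \<bar>g u - g v\<bar> \<le> edge_dist u v"
    and "u \<in> Gamma Y" "v \<in> Gamma Y"
  shows "\<bar>g u - g v\<bar> \<le> Gamma_dist Y u v"
proof (rule Gamma_dist_greatest)
  show "\<bar>g u - g v\<bar> \<le> l" if "walk Y u v l" for l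
    using that
  proof (induction rule: walk.induct)
    case (step u v l w)
    then show ?case using g[of v w] by (simp add: edge_dist_commute)
  qed simp
qed (use assms in auto)

text \<open>The distance to the vertex \<open>w\<close>, cut off at 1 so that it is constant on the edges that
  avoid \<open>w\<close>.\<close>

fun vertex_coord :: "'a pt \<Rightarrow> 'a pt \<Rightarrow> real" where
  "vertex_coord w (Vert x) = (if x = w then 0 else 1)"
| "vertex_coord w (Inner x y t) = (if w = x then t else if w = y then 1 - t else 1)"
| "vertex_coord w (Base c) = 1"

text \<open>The distance to the nearer endpoint on the oriented edge from \<open>x\<close> to \<open>y\<close>, zero elsewhere;
  it separates the interior of one edge from everything outside that edge.\<close>

fun edge_depth :: "'a pt \<Rightarrow> 'a pt \<Rightarrow> 'a pt \<Rightarrow> real" where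
  "edge_depth x y (Inner x' y' t) = (if x' = x \<and> y' = y then min t (1 - t) else 0)"
| "edge_depth x y _ = 0"

lemma Gamma_dist_ge_vertex_coord:
  assumes "u \<in> Gamma Y" "v \<in> Gamma Y"
  shows "\<bar>vertex_coord w u - vertex_coord w v\<bar> \<le> Gamma_dist Y u v"
proof (rule Gamma_dist_ge_lipschitz[OF _ assms])
  show "\<bar>vertex_coord w u - vertex_coord w v\<bar> \<le> edge_dist u v" if "on_common_edge Y u v" for u v
    using that by (cases u; cases v) (auto simp: on_common_edge_def)
qed

lemma Gamma_dist_ge_edge_depth:
  assumes "u \<in> Gamma Y" "v \<in> Gamma Y"
  shows "\<bar>edge_depth x y u - edge_depth x y v\<bar> \<le> Gamma_dist Y u v"
proof (rule Gamma_dist_ge_lipschitz[OF _ assms])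
  show "\<bar>edge_depth x y u - edge_depth x y v\<bar> \<le> edge_dist u v" if "on_common_edge Y u v" for u v
    using that by (cases u; cases v) (auto simp: on_common_edge_def min_def)
qed

lemma Gamma_dist_source_vertex:
  assumes "a \<in> Y" "Inner a b t \<in> Gamma Y"
  shows "Gamma_dist Y (Vert a) (Inner a b t) = t"
proof -
  have "on_common_edge Y (Vert a) (Inner a b t)" using assms by (auto simp: on_common_edge_def)
  from Gamma_dist_le_edge[OF this] show ?thesis
    using Gamma_dist_ge_vertex_coord[of "Vert a" Y "Inner a b t" a] assms by simp
qed

lemma Gamma_dist_target_vertex:
  assumes "Inner a b t \<in> Gamma Y"
  shows "Gamma_dist Y (Vert b) (Inner a b t) = 1 - t"
proof -
  have "on_common_edge Y (Vert b) (Inner a b t)" using assms by (auto simp: on_common_edge_def)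
  from Gamma_dist_le_edge[OF this] show ?thesis
    using Gamma_dist_ge_vertex_coord[of "Vert b" Y "Inner a b t" b] assms by auto
qed

lemma Gamma_dist_same_edge:
  assumes "Inner a b t \<in> Gamma Y" "Inner a b s \<in> Gamma Y"
  shows "Gamma_dist Y (Inner a b t) (Inner a b s) = \<bar>t - s\<bar>"
proof -
  have "on_common_edge Y (Inner a b t) (Inner a b s)"
    using assms by (auto simp: on_common_edge_def)
  from Gamma_dist_le_edge[OF this] show ?thesis
    using Gamma_dist_ge_vertex_coord[OF assms, of a] by simp
qed

lemma Gamma_dist_distinct_vertices:
  assumes "a \<in> Y" "b \<in> Y" "a \<noteq> b"
  shows "1 \<le> Gamma_dist Y (Vert a) (Vert b)"
  using Gamma_dist_ge_vertex_coord[of "Vert a" Y "Vert b" a] assms by auto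

text \<open>The open ball of radius 1 around a vertex is an open star, because \<open>vertex_coord w\<close> is 1 at all
  other vertices and on all edges that avoid \<open>w\<close>.\<close>

lemma near_vertexE:
  assumes "w \<in> Y" "z \<in> Gamma Y" "Gamma_dist Y (Vert w) z < 1"
  obtains (centre) "z = Vert w"
    | (out) c t where "z = Inner w c t" "Gamma_dist Y (Vert w) z = t"
    | (into) c t where "z = Inner c w t" "c \<noteq> w" "Gamma_dist Y (Vert w) z = 1 - t"
  using assms(2)
proof (cases rule: GammaE)
  case (Vert x)
  then show ?thesis using assms Gamma_dist_distinct_vertices[of w Y x] centre by force
next
  case (Inner x y t)
  have "\<bar>vertex_coord w (Vert w) - vertex_coord w z\<bar> < 1"
    using Gamma_dist_ge_vertex_coord[of "Vert w" Y z w] assms by auto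
  then have "w = x \<or> w = y" using Inner by (auto split: if_splits)
  then show ?thesis
    using Inner out[of y t] into[of x t] Gamma_dist_source_vertex[of w Y y t]
      Gamma_dist_target_vertex[of x w t Y]
    by auto
qed

text \<open>The depth of a point inside its edge bounds its distance to everything outside this edge from
  below.\<close>

lemma near_innerE:
  assumes "Inner x y t \<in> Gamma Y" "z \<in> Gamma Y"
    "Gamma_dist Y (Inner x y t) z < min t (1 - t)"
  obtains s where "z = Inner x y s" "\<bar>t - s\<bar> = Gamma_dist Y (Inner x y t) z"
proof -
  have *: "edge_depth x y z \<noteq> 0"
    using Gamma_dist_ge_edge_depth[OF assms(1,2), of x y] assms by auto
  then obtain s where "z = Inner x y s" by (cases z) (auto split: if_splits)
  then show ?thesis using Gamma_dist_same_edge[of x y t Y s] assms that by auto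
qed

lemma Metric_space_Gamma: "Metric_space (Gamma Y) (Gamma_dist Y)"
proof
  show "Gamma_dist Y u v = 0 \<longleftrightarrow> u = v" if uv: "u \<in> Gamma Y" "v \<in> Gamma Y" for u v
  proof
    assume 0: "Gamma_dist Y u v = 0"
    show "u = v" using uv(1)
    proof (cases rule: GammaE)
      case (Vert x)
      with 0 uv have "x \<in> Y" "v \<in> Gamma Y" "Gamma_dist Y (Vert x) v < 1" by auto
      then show ?thesis by (cases rule: near_vertexE) (use 0 uv Vert in auto)
    next
      case (Inner x y t)
      with 0 uv have "Inner x y t \<in> Gamma Y" "v \<in> Gamma Y"
        "Gamma_dist Y (Inner x y t) v < min t (1 - t)" by auto
      then obtain s where "v = Inner x y s" "\<bar>t - s\<bar> = Gamma_dist Y (Inner x y t) v"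
        by (rule near_innerE)
      then show ?thesis using 0 Inner by simp
    qed
  qed simp
qed (auto simp: Gamma_dist_nonneg Gamma_dist_commute Gamma_dist_triangle)

section \<open>Completeness of the complete oriented graph\<close>

fun depth :: "'a pt \<Rightarrow> real" where
  "depth (Inner x y t) = min t (1 - t)"
| "depth _ = 0"

text \<open>If the terms of a Cauchy sequence stay away from the vertices infinitely often, the sequence
  is eventually trapped in a compact part of one open edge; otherwise its terms approach the
  vertices, and as these are at mutual distance at least 1, a single vertex.\<close>

lemma mcomplete_Gamma: "Metric_space.mcomplete (Gamma Y) (Gamma_dist Y)"
proof -
  interpret Metric_space "Gamma Y" "Gamma_dist Y" by (rule Metric_space_Gamma)
  show ?thesis unfolding mcomplete_def
  proof (intro allI impI)
    fix \<sigma> assume \<sigma>: "MCauchy \<sigma>"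
    then have in\<Gamma>: "\<sigma> n \<in> Gamma Y" for n by (auto simp: MCauchy_def)
    have Cau: "\<exists>N. \<forall>n n'. N \<le> n \<longrightarrow> N \<le> n' \<longrightarrow> Gamma_dist Y (\<sigma> n) (\<sigma> n') < \<epsilon>" if "\<epsilon> > 0" for \<epsilon>
      using \<sigma> that by (auto simp: MCauchy_def)
    show "\<exists>l. limitin mtopology \<sigma> l sequentially"
    proof (cases "\<exists>\<epsilon>>0. \<forall>N. \<exists>n\<ge>N. \<epsilon> \<le> depth (\<sigma> n)")
      case True
      then obtain \<epsilon> where \<epsilon>: "\<epsilon> > 0" "\<And>N. \<exists>n\<ge>N. \<epsilon> \<le> depth (\<sigma> n)" by blast
      obtain N where N: "\<And>n n'. N \<le> n \<Longrightarrow> N \<le> n' \<Longrightarrow> Gamma_dist Y (\<sigma> n) (\<sigma> n') < \<epsilon> / 2"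
        using Cau[of "\<epsilon> / 2"] \<epsilon>(1) by auto
      obtain n0 where n0: "n0 \<ge> N" "\<epsilon> \<le> depth (\<sigma> n0)" using \<epsilon>(2) by blast
      then obtain x y t0 where t0: "\<sigma> n0 = Inner x y t0"
        using \<epsilon>(1) by (cases "\<sigma> n0") auto
      define c where "c n = vertex_coord x (\<sigma> n)" for n
      have tail: "\<sigma> n = Inner x y (c n) \<and> \<epsilon> / 2 \<le> c n \<and> c n \<le> 1 - \<epsilon> / 2" if "n \<ge> n0" for n
      proof -
        have "\<bar>edge_depth x y (\<sigma> n0) - edge_depth x y (\<sigma> n)\<bar> < \<epsilon> / 2"
          using Gamma_dist_ge_edge_depth[OF in\<Gamma> in\<Gamma>, of x y n0 n] N[of n0 n] n0 that by linarith
        moreover have "edge_depth x y (\<sigma> n0) = depth (\<sigma> n0)" using t0 by simp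
        ultimately have "\<epsilon> / 2 \<le> edge_depth x y (\<sigma> n)" using n0 by linarith
        then show ?thesis using \<epsilon>(1) by (cases "\<sigma> n") (auto simp: c_def min_def split: if_splits)
      qed
      have "Cauchy c"
      proof (rule metric_CauchyI)
        fix r :: real assume "r > 0"
        then obtain K where "\<And>n n'. K \<le> n \<Longrightarrow> K \<le> n' \<Longrightarrow> Gamma_dist Y (\<sigma> n) (\<sigma> n') < r"
          using Cau by blast
        moreover have "dist (c n) (c n') \<le> Gamma_dist Y (\<sigma> n) (\<sigma> n')" for n n'
          using Gamma_dist_ge_vertex_coord[OF in\<Gamma> in\<Gamma>] by (simp add: c_def dist_real_def)
        ultimately show "\<exists>M. \<forall>m\<ge>M. \<forall>n\<ge>M. dist (c m) (c n) < r"
          by (meson order_le_less_trans)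
      qed
      then obtain l where l: "c \<longlonglongrightarrow> l" using Cauchy_convergent_iff convergent_def by blast
      have "\<epsilon> / 2 \<le> l" using tail by (intro LIMSEQ_le_const[OF l]) blast
      moreover have "l \<le> 1 - \<epsilon> / 2" using tail by (intro LIMSEQ_le_const2[OF l]) blast
      ultimately have lin: "Inner x y l \<in> Gamma Y" using \<epsilon>(1) in\<Gamma>[of n0] t0 by auto
      have "limitin mtopology \<sigma> (Inner x y l) sequentially"
        unfolding limitin_metric
      proof (intro conjI allI impI)
        fix r :: real assume "r > 0"
        then have "\<forall>\<^sub>F n in sequentially. dist (c n) l < r" using l by (simp add: tendsto_iff)
        then show "\<forall>\<^sub>F n in sequentially. \<sigma> n \<in> Gamma Y \<and> Gamma_dist Y (\<sigma> n) (Inner x y l) < r"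
          using eventually_ge_at_top[of n0]
        proof eventually_elim
          case (elim n)
          then show ?case
            using tail[of n] in\<Gamma>[of n] Gamma_dist_same_edge[of x y "c n" Y l] lin
            by (auto simp: dist_real_def)
        qed
      qed (rule lin)
      then show ?thesis by blast
    next
      case False
      then have shallow: "\<exists>N. \<forall>n\<ge>N. depth (\<sigma> n) < \<epsilon>" if "\<epsilon> > 0" for \<epsilon>
        using that by (meson not_less)
      obtain N0 where N0: "\<And>n n'. N0 \<le> n \<Longrightarrow> N0 \<le> n' \<Longrightarrow> Gamma_dist Y (\<sigma> n) (\<sigma> n') < 1 / 4"
        using Cau[of "1 / 4"] by auto
      obtain N1 where N1: "\<And>n. N1 \<le> n \<Longrightarrow> depth (\<sigma> n) < 1 / 4"
        using shallow[of "1 / 4"] by auto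
      define N where "N = max N0 N1"
      obtain w where w: "w \<in> Y" "Gamma_dist Y (Vert w) (\<sigma> N) < 1 / 4"
        using in\<Gamma>[of N]
      proof (cases rule: GammaE)
        case (Vert x)
        then show ?thesis using that[of x] by simp
      next
        case (Inner x y t)
        then have "min t (1 - t) < 1 / 4" using N1[of N] by (simp add: N_def)
        then show ?thesis
          using that[of x] that[of y] Inner in\<Gamma>[of N] Gamma_dist_source_vertex[of x Y y t]
            Gamma_dist_target_vertex[of x y t Y] by (auto simp: min_def split: if_splits)
      qed
      have eq: "Gamma_dist Y (Vert w) (\<sigma> n) = depth (\<sigma> n)" if "n \<ge> N" for n
      proof -
        have "Gamma_dist Y (Vert w) (\<sigma> n) < 1 / 2"
          using Gamma_dist_triangle[of "Vert w" Y "\<sigma> N" "\<sigma> n"] N0[of N n] w in\<Gamma> that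
          by (auto simp: N_def)
        then have "w \<in> Y" "\<sigma> n \<in> Gamma Y" "Gamma_dist Y (Vert w) (\<sigma> n) < 1"
            and *: "Gamma_dist Y (Vert w) (\<sigma> n) < 1 / 2"
          using w in\<Gamma> by auto
        then show ?thesis by (cases rule: near_vertexE) auto
      qed
      have "limitin mtopology \<sigma> (Vert w) sequentially"
        unfolding limitin_metric
      proof (intro conjI allI impI)
        fix r :: real assume "r > 0"
        then obtain K where "\<And>n. K \<le> n \<Longrightarrow> depth (\<sigma> n) < r" using shallow by blast
        then show "\<forall>\<^sub>F n in sequentially. \<sigma> n \<in> Gamma Y \<and> Gamma_dist Y (\<sigma> n) (Vert w) < r"
          unfolding eventually_sequentially using eq in\<Gamma>
          by (intro exI[of _ "max N K"]) (auto simp: Gamma_dist_commute[of _ _ "Vert w"])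
      qed (use w in simp)
      then show ?thesis by blast
    qed
  qed
qed

section \<open>One cobweb\<close>

fun foot :: "'a pt \<Rightarrow> 'a pt" where
  "foot (Vert x) = x"
| "foot (Inner x y t) = x"
| "foot (Base c) = Base c"

lemma mem_Zset:
  assumes "a \<in> Y"
  shows "z \<in> Zset Y e a \<longleftrightarrow> z = Vert a \<or>
    (\<exists>b t. z = Inner a b t \<and> b \<in> Y \<and> b \<noteq> a \<and> 0 < t \<and> t < 1 \<and> trunc_dist e b a \<le> 1 - t)"
proof -
  have "Gamma_dist Y (Vert a) (Inner a b t) = t" if "b \<in> Y" "b \<noteq> a" "0 < t" "t < 1" for b t
    using assms that by (intro Gamma_dist_source_vertex) auto
  then show ?thesis
    using assms by (cases z) (auto simp: Zset_def segment_def)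
qed

lemma mem_Cob [simp]:
  "Vert x \<in> Cob Y e \<longleftrightarrow> x \<in> Y"
  "Inner a b t \<in> Cob Y e \<longleftrightarrow>
    a \<in> Y \<and> b \<in> Y \<and> a \<noteq> b \<and> 0 < t \<and> t < 1 \<and> trunc_dist e b a \<le> 1 - t"
  "Base c \<notin> Cob Y e"
  by (auto simp: Cob_def mem_Zset)

lemma CobE:
  assumes "z \<in> Cob Y e"
  obtains (Vert) x where "z = Vert x" "x \<in> Y"
    | (Inner) a b t where "z = Inner a b t" "a \<in> Y" "b \<in> Y" "a \<noteq> b" "0 < t" "t < 1"
        "trunc_dist e b a \<le> 1 - t"
  using assms by (cases z) auto

lemma Zset_eq: "a \<in> Y \<Longrightarrow> Zset Y e a = {z \<in> Cob Y e. foot z = a}"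
  by (rule set_eqI, subst mem_Zset) (auto elim!: CobE)

lemma foot_in: "z \<in> Cob Y e \<Longrightarrow> foot z \<in> Y"
  by (auto elim: CobE)

lemma compression_eq_foot: "z \<in> Cob Y e \<Longrightarrow> compression Y e z = foot z"
  unfolding compression_def by (rule the_equality) (auto simp: Zset_eq foot_in)

lemma Cob_subset_Gamma: "Cob Y e \<subseteq> Gamma Y"
  by (auto elim!: CobE)

lemma Metric_space_Cob: "Metric_space (Cob Y e) (Gamma_dist Y)"
  using Metric_space.subspace[OF Metric_space_Gamma Cob_subset_Gamma] .

abbreviation cob_topology :: "'a pt set \<Rightarrow> ('a pt \<Rightarrow> 'a pt \<Rightarrow> real) \<Rightarrow> 'a pt topology" where
  "cob_topology Y e \<equiv> Metric_space.mtopology (Cob Y e) (Gamma_dist Y)"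

lemma mcomplete_Cob: "Metric_space.mcomplete (Cob Y e) (Gamma_dist Y)"
proof -
  interpret Submetric "Gamma Y" "Gamma_dist Y" "Cob Y e"
    by (intro Submetric.intro Submetric_axioms.intro Metric_space_Gamma Cob_subset_Gamma)
  have "closedin mtopology (Cob Y e)"
    unfolding closedin_metric
  proof (intro conjI allI impI)
    fix z assume z: "z \<in> Gamma Y - Cob Y e"
    then obtain a b t where t: "z = Inner a b t" "a \<in> Y" "b \<in> Y" "a \<noteq> b" "0 < t" "t < 1"
        "1 - t < trunc_dist e b a"
      by (cases z) auto
    \<comment> \<open>A ball of this radius lies in the open edge, beyond the end of the ray.\<close>
    define r where "r = Min {t, 1 - t, t - 1 + trunc_dist e b a}"
    have r: "r > 0" "r \<le> t" "r \<le> 1 - t" "r \<le> t - 1 + trunc_dist e b a"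
      using t by (auto simp: r_def)
    have "y \<notin> Cob Y e" if y: "y \<in> mball z r" for y
    proof -
      have "Inner a b t \<in> Gamma Y" "y \<in> Gamma Y" "Gamma_dist Y (Inner a b t) y < min t (1 - t)"
        using y t r by auto
      then obtain s where "y = Inner a b s" "\<bar>t - s\<bar> = Gamma_dist Y (Inner a b t) y"
        by (rule near_innerE)
      then show ?thesis using y t r by (auto simp: trunc_dist_def)
    qed
    then show "\<exists>r>0. disjnt (Cob Y e) (mball z r)" using r by (auto simp: disjnt_iff)
  qed (rule Cob_subset_Gamma)
  then show ?thesis using closedin_mcomplete_imp_mcomplete mcomplete_Gamma by blast
qed

text \<open>Pointwise continuity of the compression map. Near the vertex \<open>a\<close> a point of another star \<open>Z\<^sub>c\<close>
  lies on the ray from \<open>c\<close> to \<open>a\<close>; this ray stops at distance \<open>min (e a c) (1/2)\<close> from \<open>a\<close>, so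
  closeness to \<open>a\<close> forces \<open>e a c\<close> to be small.\<close>

lemma foot_continuous_at:
  assumes "distance_space Y e" and z: "z \<in> Cob Y e" and "r > 0"
  shows "\<exists>s>0. \<forall>z'\<in>Cob Y e. Gamma_dist Y z z' < s \<longrightarrow> e (foot z) (foot z') < r"
  using z
proof (cases rule: CobE)
  case (Vert a)
  interpret distance_space Y e by fact
  show ?thesis
  proof (intro exI[of _ "min r (1/2)"] conjI ballI impI)
    fix z' assume z': "z' \<in> Cob Y e" "Gamma_dist Y z z' < min r (1/2)"
    then have "a \<in> Y" "z' \<in> Gamma Y" "Gamma_dist Y (Vert a) z' < 1"
      using Vert Cob_subset_Gamma by auto
    then show "e (foot z) (foot z') < r"
      by (cases rule: near_vertexE)
         (use z' Vert \<open>r > 0\<close> refl_zero in \<open>auto simp: trunc_dist_def\<close>)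
  qed (use \<open>r > 0\<close> in auto)
next
  case (Inner a b t)
  interpret distance_space Y e by fact
  show ?thesis
  proof (intro exI[of _ "min t (1 - t)"] conjI ballI impI)
    fix z' assume z': "z' \<in> Cob Y e" "Gamma_dist Y z z' < min t (1 - t)"
    then have "Inner a b t \<in> Gamma Y" "z' \<in> Gamma Y"
        "Gamma_dist Y (Inner a b t) z' < min t (1 - t)"
      using Inner Cob_subset_Gamma by auto
    then obtain s where "z' = Inner a b s" by (rule near_innerE)
    then show "e (foot z) (foot z') < r" using Inner \<open>r > 0\<close> refl_zero by simp
  qed (use Inner in auto)
qed

lemma topspace_distance_topology [simp]: "topspace (distance_topology Y e) = Y"
proof -
  have "distance_open Y e Y"
    by (auto simp: distance_open_def dball_def intro!: exI[of _ 1])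
  then show ?thesis
    unfolding topspace_def openin_distance_topology by (auto simp: distance_open_def)
qed

lemma distance_topology_metric:
  assumes "Metric_space Y e"
  shows "distance_topology Y e = Metric_space.mtopology Y e"
proof -
  interpret Metric_space Y e by fact
  have "mball x r = dball Y e x r" if "x \<in> Y" for x r
    using that by (auto simp: dball_def)
  then show ?thesis
    unfolding topology_eq openin_distance_topology distance_open_def openin_mtopology
    by (metis subsetD)
qed

lemma continuous_map_foot:
  assumes "distance_space Y e"
  shows "continuous_map (cob_topology Y e) (distance_topology Y e) foot"
proof -
  interpret Metric_space "Cob Y e" "Gamma_dist Y" by (rule Metric_space_Cob)
  show ?thesis
    unfolding continuous_map_from_metric
  proof (intro conjI ballI allI impI)
    fix z U assume z: "z \<in> Cob Y e" and "openin (distance_topology Y e) U \<and> foot z \<in> U"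
    then obtain r where r: "r > 0" "dball Y e (foot z) r \<subseteq> U"
      unfolding openin_distance_topology distance_open_def by blast
    obtain s where s: "s > 0"
        "\<forall>z'\<in>Cob Y e. Gamma_dist Y z z' < s \<longrightarrow> e (foot z) (foot z') < r"
      using foot_continuous_at[OF assms z r(1)] by blast
    have "foot x \<in> U" if "x \<in> Cob Y e" "Gamma_dist Y z x < s" for x
      using that s r(2) foot_in[OF that(1)] by (auto simp: dball_def)
    then show "\<exists>s>0. \<forall>x. x \<in> Cob Y e \<and> Gamma_dist Y z x < s \<longrightarrow> foot x \<in> U"
      using s(1) by blast
  qed (auto simp: foot_in)
qed

text \<open>A star is connected because each of its rays is a Lipschitz image of an interval.\<close>

lemma connectedin_Zset:
  assumes a: "a \<in> Y"
  shows "connectedin (cob_topology Y e) (Zset Y e a)"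
proof -
  interpret Metric_space "Cob Y e" "Gamma_dist Y" by (rule Metric_space_Cob)
  define \<phi> where "\<phi> b t = (if t = 0 then Vert a else Inner a b t)" for b t
  define I where "I b = {t. 0 \<le> t \<and> t < 1 \<and> t \<le> 1 - trunc_dist e b a}" for b
  have "connectedin mtopology (\<phi> b ` I b)" if b: "b \<in> Y" "b \<noteq> a" for b
  proof (rule connectedin_continuous_map_image)
    have "is_interval (I b)" by (auto simp: is_interval_1 I_def)
    then show "connectedin (top_of_set (I b)) (I b)"
      by (simp add: connectedin_subtopology is_interval_connected)
    have in\<Gamma>: "\<phi> b t \<in> Cob Y e" if "t \<in> I b" for t
      using that a b by (auto simp: \<phi>_def I_def)
    have Lip: "Gamma_dist Y (\<phi> b t) (\<phi> b s) \<le> \<bar>t - s\<bar>" if "t \<in> I b" "s \<in> I b" for t s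
      using that a b
      by (auto simp: \<phi>_def I_def Gamma_dist_source_vertex Gamma_dist_same_edge 
          Gamma_dist_commute[of _ _ "Vert a"])
    show "continuous_map (top_of_set (I b)) mtopology (\<phi> b)"
      unfolding continuous_map_to_metric
    proof (intro ballI allI impI)
      fix t r :: real assume "t \<in> topspace (top_of_set (I b))" and "r > 0"
      then show "\<exists>U. openin (top_of_set (I b)) U \<and> t \<in> U \<and> (\<forall>y\<in>U. \<phi> b y \<in> mball (\<phi> b t) r)"
        using Lip[of t] in\<Gamma>
        by (intro exI[of _ "I b \<inter> ball t r"]) (force simp: dist_real_def)
    qed
  qed
  moreover have "connectedin mtopology {Vert a}" using a by simp
  moreover have "Zset Y e a = \<Union>(insert {Vert a} ((\<lambda>b. \<phi> b ` I b) ` (Y - {a})))"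
  proof (rule set_eqI)
    have "Vert a \<in> \<phi> b ` I b" for b
      by (rule image_eqI[of _ _ 0]) (auto simp: \<phi>_def I_def trunc_dist_def)
    then show "z \<in> Zset Y e a \<longleftrightarrow> z \<in> \<Union>(insert {Vert a} ((\<lambda>b. \<phi> b ` I b) ` (Y - {a})))" for z
      unfolding mem_Zset[OF a] by (auto simp: \<phi>_def I_def image_iff)
  qed
  moreover have "Vert a \<in> \<phi> b ` I b" for b
    by (rule image_eqI[of _ _ 0]) (auto simp: \<phi>_def I_def trunc_dist_def)
  then have "Vert a \<in> \<Inter>(insert {Vert a} ((\<lambda>b. \<phi> b ` I b) ` (Y - {a})))" by auto
  then have "\<Inter>(insert {Vert a} ((\<lambda>b. \<phi> b ` I b) ` (Y - {a}))) \<noteq> {}" by blast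
  ultimately show ?thesis
    using connectedin_Union[of "insert {Vert a} ((\<lambda>b. \<phi> b ` I b) ` (Y - {a}))" mtopology]
    by (metis (no_types, lifting) Diff_iff imageE insert_iff)
qed

text \<open>This is what makes compression a quotient map: the star of a point \<open>b\<close> that is close to \<open>a\<close>
  contains points close to the vertex \<open>a\<close>, namely on its ray towards \<open>a\<close>.\<close>

lemma star_approaches_vertex:
  assumes "distance_space Y e" and a: "a \<in> Y" and b: "b \<in> Y" and ab: "e a b < r"
  shows "\<exists>z\<in>Cob Y e. foot z = b \<and> Gamma_dist Y (Vert a) z < r"
proof (cases "a = b")
  case True
  interpret distance_space Y e by fact
  have "0 < r" using nonneg[OF a b] ab by simp
  then show ?thesis using True b by (intro bexI[of _ "Vert b"]) auto
next
  case False
  interpret distance_space Y e by fact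
  have r: "0 < r" using nonneg[OF a b] ab by simp
  \<comment> \<open>The distance \<open>s\<close> from \<open>a\<close> must be positive even if \<open>e a b = 0\<close>.\<close>
  define s where "s = max (trunc_dist e a b) (min (r/2) (1/2))"
  have s: "0 < s" "s < r" "s < 1" "trunc_dist e a b \<le> s"
    using r ab by (auto simp: s_def trunc_dist_def)
  then have z: "Inner b a (1 - s) \<in> Cob Y e" using a b False by auto
  then have "Inner b a (1 - s) \<in> Gamma Y" using Cob_subset_Gamma by blast
  from Gamma_dist_target_vertex[OF this] show ?thesis
    using z s by (intro bexI[of _ "Inner b a (1 - s)"]) auto
qed

section \<open>Separable connected subsets of a cobweb over a metric space\<close>

text \<open>If all distances between distinct points are positive, every ray stops before it reaches its
  target. A ray without its starting vertex is then clopen in the complement of this vertex, so a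
  connected set that meets a star off its centre and omits the centre stays in one ray.\<close>

lemma connectedin_missing_centre:
  assumes pos: "\<And>a b. \<lbrakk>a \<in> Y; b \<in> Y; a \<noteq> b\<rbrakk> \<Longrightarrow> 0 < e a b"
    and conn: "connectedin (cob_topology Y e) C"
    and "z \<in> C" "Vert (foot z) \<notin> C"
  shows "foot ` C = {foot z}"
proof -
  interpret Metric_space "Cob Y e" "Gamma_dist Y" by (rule Metric_space_Cob)
  have sub: "C \<subseteq> Cob Y e" using connectedin_subset_topspace[OF conn] by simp
  then have \<Gamma>: "w \<in> Gamma Y" if "w \<in> C" for w using that Cob_subset_Gamma by blast
  have "z \<in> Cob Y e" using sub \<open>z \<in> C\<close> by blast
  then obtain a b t where z: "z = Inner a b t" "a \<in> Y" "b \<in> Y" "a \<noteq> b"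
    by (cases rule: CobE) (use assms in auto)
  define R where "R = range (Inner a b)"
  have inner: "y \<in> range (Inner x x')"
    if "Inner x x' t \<in> C" "y \<in> C" "y \<in> mball (Inner x x' t) (min t (1 - t))" for x x' t y
  proof -
    have "Inner x x' t \<in> Gamma Y" "y \<in> Gamma Y"
        "Gamma_dist Y (Inner x x' t) y < min t (1 - t)"
      using that \<Gamma> by auto
    then show ?thesis by (rule near_innerE) auto
  qed
  \<comment> \<open>The sets \<open>C \<inter> R\<close> and \<open>C - R\<close> are separated: an interior point of an edge has a neighbourhood
    inside that edge, and the only vertex adherent to \<open>R\<close> is the missing one.\<close>
  have "(C \<inter> R) \<inter> mtopology closure_of (C - R) = {}"
  proof -
    have "w \<notin> mtopology closure_of (C - R)" if "w \<in> C \<inter> R" for w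
    proof
      assume w: "w \<in> mtopology closure_of (C - R)"
      have "w \<in> range (Inner a b)" using that by (auto simp: R_def)
      then obtain s where s: "w = Inner a b s" by blast
      then have "0 < min s (1 - s)" using \<Gamma>[of w] that by auto
      then obtain y where "y \<in> C - R" "y \<in> mball w (min s (1 - s))"
        using w unfolding metric_closure_of by blast
      then show False using inner[of a b s y] s that by (auto simp: R_def)
    qed
    then show ?thesis by blast
  qed
  moreover have "(C - R) \<inter> mtopology closure_of (C \<inter> R) = {}"
  proof -
    have "w \<notin> mtopology closure_of (C \<inter> R)" if "w \<in> C - R" for w
    proof
      assume w: "w \<in> mtopology closure_of (C \<inter> R)"
      have "w \<in> Gamma Y" using \<Gamma> that by blast
      then show False
      proof (cases rule: GammaE)
        case (Vert v)
        have "0 < trunc_dist e b a" using pos z by (simp add: trunc_dist_def)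
        then obtain y where y: "y \<in> C \<inter> R" "y \<in> mball w (trunc_dist e b a)"
          using w unfolding metric_closure_of by blast
        have "v \<in> Y" "y \<in> Gamma Y" and near: "Gamma_dist Y (Vert v) y < 1"
          using Vert \<Gamma> y that by (auto simp: trunc_dist_def)
        have "v \<noteq> a" using that Vert assms z by auto
        obtain s where s: "y = Inner a b s" using y by (auto simp: R_def)
        from \<open>v \<in> Y\<close> \<open>y \<in> Gamma Y\<close> near have "v = b \<and> Gamma_dist Y (Vert v) y = 1 - s"
          by (cases rule: near_vertexE) (use s \<open>v \<noteq> a\<close> in auto)
        then show False using y s sub Vert by auto
      next
        case (Inner x x' s)
        then have "0 < min s (1 - s)" by auto
        then obtain y where "y \<in> C \<inter> R" "y \<in> mball w (min s (1 - s))"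
          using w unfolding metric_closure_of by blast
        then show False using inner[of x x' s y] Inner that by (auto simp: R_def)
      qed
    qed
    then show ?thesis by blast
  qed
  moreover have "C \<inter> R \<noteq> {}" using z \<open>z \<in> C\<close> by (auto simp: R_def)
  moreover have "(C \<inter> R) \<union> (C - R) = C" by blast
  ultimately have "C - R = {}"
    using conn unfolding connectedin_separation by metis
  then show ?thesis using \<open>z \<in> C\<close> z by (force simp: R_def)
qed

text \<open>Vertices are at mutual distance at least 1, so a separable set contains countably many.\<close>

lemma countable_centres:
  assumes sep: "separable_space (subtopology (cob_topology Y e) C)" and sub: "C \<subseteq> Cob Y e"
  shows "countable {a. Vert a \<in> C}"
proof -
  interpret Metric_space "Cob Y e" "Gamma_dist Y" by (rule Metric_space_Cob)
  obtain Q where Q: "countable Q" "Q \<subseteq> C" "subtopology mtopology C closure_of Q = C"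
    using sep sub by (auto simp: separable_space_def Int_absorb1)
  \<comment> \<open>A point is within distance 1/2 of at most one vertex.\<close>
  define g where "g q = (SOME a. a \<in> Y \<and> Gamma_dist Y (Vert a) q < 1/2)" for q
  have "{a. Vert a \<in> C} \<subseteq> g ` Q"
  proof
    fix a assume "a \<in> {a. Vert a \<in> C}"
    then have aC: "Vert a \<in> C" by simp
    then have aY: "a \<in> Y" using sub by auto
    have "Vert a \<in> mtopology closure_of Q"
      using aC Q(2,3) closure_of_subtopology[of mtopology C Q] by (auto simp: Int_absorb1)
    then have "\<forall>r>0. \<exists>q\<in>Q. q \<in> mball (Vert a) r" unfolding metric_closure_of by blast
    then have "\<exists>q\<in>Q. q \<in> mball (Vert a) (1/2)" by (meson half_gt_zero zero_less_one)
    then obtain q where q: "q \<in> Q" "Gamma_dist Y (Vert a) q < 1/2" by auto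
    have "g q = a"
      unfolding g_def
    proof (rule some_equality)
      fix b assume b: "b \<in> Y \<and> Gamma_dist Y (Vert b) q < 1/2"
      have "q \<in> Gamma Y" using q Q sub Cob_subset_Gamma by blast
      then have "Gamma_dist Y (Vert a) (Vert b) < 1"
        using Gamma_dist_triangle[of "Vert a" Y q "Vert b"] Gamma_dist_commute[of Y q] aY b q
        by auto
      then show "b = a" using Gamma_dist_distinct_vertices[of a Y b] aY b by force
    qed (use aY q in auto)
    then show "a \<in> g ` Q" using q by blast
  qed
  then show ?thesis using Q(1) countable_subset by blast
qed

text \<open>If two stars were met, the set would contain the centre of every star that it meets; its
  image under \<open>foot\<close> would then be a countable connected set with two points in a metric space.\<close>

lemma foot_constant_on_separable_connected:
  assumes Y: "Metric_space Y e"
    and conn: "connectedin (cob_topology Y e) C"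
    and sep: "separable_space (subtopology (cob_topology Y e) C)"
    and z: "z \<in> C" "z' \<in> C"
  shows "foot z = foot z'"
proof (rule ccontr)
  assume ne: "foot z \<noteq> foot z'"
  interpret Y: Metric_space Y e by fact
  have ds: "distance_space Y e" by unfold_locales auto
  have sub: "C \<subseteq> Cob Y e"
    using connectedin_subset_topspace[OF conn]
    by (simp add: Metric_space.topspace_mtopology[OF Metric_space_Cob])
  have pos: "0 < e a b" if "a \<in> Y" "b \<in> Y" "a \<noteq> b" for a b
    using Y.zero[OF that(1,2)] Y.nonneg[of a b] that(3) by linarith
  have "Vert a \<in> C" if "a \<in> foot ` C" for a
    using connectedin_missing_centre[OF pos conn] that ne z by (metis imageE imageI singletonD)
  then have "foot ` C \<subseteq> {a. Vert a \<in> C}" by blast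
  then have "countable (foot ` C)" using countable_centres[OF sep sub] countable_subset by blast
  moreover have "connectedin Y.mtopology (foot ` C)"
    using connectedin_continuous_map_image[OF continuous_map_foot[OF ds] conn]
    by (simp add: distance_topology_metric[OF Y])
  then have "connected_space (subtopology Y.mtopology (foot ` C))" "foot ` C \<subseteq> Y"
    by (auto simp: connectedin_def)
  moreover have "metrizable_space (subtopology Y.mtopology (foot ` C))"
    by (simp add: Y.metrizable_space_mtopology metrizable_space_subtopology)
  moreover have "\<not> (\<exists>a. foot ` C \<subseteq> {a})" using ne z by blast
  ultimately show False
    using connected_space_imp_uncountable[of "subtopology Y.mtopology (foot ` C)"]
    by (simp add: metrizable_imp_regular_space metrizable_imp_Hausdorff_space Int_absorb1)
qed

section \<open>The inverse limit\<close>

context distance_space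
begin

abbreviation stage :: "nat \<Rightarrow> 'a pt set" where
  "stage n \<equiv> Cob_iter X d n"

abbreviation stage_dist :: "nat \<Rightarrow> 'a pt \<Rightarrow> 'a pt \<Rightarrow> real" where
  "stage_dist n \<equiv> cob_metric X d n"

abbreviation limit :: "(nat \<Rightarrow> 'a pt) set" where
  "limit \<equiv> Cob_omega X d"

abbreviation limit_topology :: "(nat \<Rightarrow> 'a pt) topology" where
  "limit_topology \<equiv> Cob_omega_topology X d"

lemma stage_0:
  "stage 0 = Base ` X" "stage_dist 0 = (\<lambda>u v. d (of_Base u) (of_Base v))"
  by (simp_all add: Cob_iter_def cob_metric_def)

lemma stage_Suc:
  "stage (Suc n) = Cob (stage n) (stage_dist n)" "stage_dist (Suc n) = Gamma_dist (stage n)"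
  by (simp_all add: Cob_iter_def cob_metric_def case_prod_beta)

lemma Metric_space_stage: "Metric_space (stage (Suc n)) (stage_dist (Suc n))"
  by (simp add: stage_Suc Metric_space_Cob)

lemma distance_space_stage: "distance_space (stage n) (stage_dist n)"
proof (cases n)
  case 0
  then show ?thesis by unfold_locales (auto simp: stage_0 nonneg refl_zero)
next
  case (Suc m)
  interpret Metric_space "stage n" "stage_dist n" using Metric_space_stage Suc by simp
  show ?thesis by unfold_locales auto
qed

lemma cob_proj_eq_foot: "z \<in> stage (Suc n) \<Longrightarrow> cob_proj X d n z = foot z"
  by (simp add: cob_proj_def stage_Suc compression_eq_foot)

lemma foot_in_stage: "z \<in> stage (Suc n) \<Longrightarrow> foot z \<in> stage n"
  by (simp add: stage_Suc foot_in)

lemma mem_limit: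
  "x \<in> limit \<longleftrightarrow> x \<in> Pi\<^sub>E {1..} stage \<and> (\<forall>n\<ge>1. foot (x (Suc n)) = x n)"
  unfolding Cob_omega_def using cob_proj_eq_foot by (auto simp: PiE_iff)

text \<open>On the limit this is \<open>x n\<close> for \<open>n \<ge> 1\<close>. Reading it off the next coordinate makes the initial
  space, over which threads have no coordinate of their own, one more stage with \<open>n = 0\<close>.\<close>

definition coord :: "nat \<Rightarrow> (nat \<Rightarrow> 'a pt) \<Rightarrow> 'a pt" where
  "coord n x = foot (x (Suc n))"

lemma coord_eq: "x \<in> limit \<Longrightarrow> n \<ge> 1 \<Longrightarrow> coord n x = x n"
  by (simp add: coord_def mem_limit)

lemma coord_in_stage: "x \<in> limit \<Longrightarrow> coord n x \<in> stage n"
  unfolding coord_def by (rule foot_in_stage) (auto simp: mem_limit PiE_iff)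

lemma foot_coord: "x \<in> limit \<Longrightarrow> foot (coord (Suc n) x) = coord n x"
  by (simp add: coord_eq) (simp add: coord_def)

text \<open>A thread may be prescribed from any stage on; its earlier coordinates follow by compression.\<close>

lemma thread_exists:
  assumes "\<And>k. k \<ge> n \<Longrightarrow> s k \<in> stage k" "\<And>k. k \<ge> n \<Longrightarrow> foot (s (Suc k)) = s k"
  shows "\<exists>x\<in>limit. \<forall>k\<ge>n. coord k x = s k"
  using assms
proof (induction n arbitrary: s)
  case 0
  let ?x = "\<lambda>k. if k = 0 then undefined else s k"
  have "?x \<in> limit" using 0 by (auto simp: mem_limit PiE_iff extensional_def)
  moreover have "\<forall>k\<ge>0. coord k ?x = s k" using 0 by (simp add: coord_def)
  ultimately show ?case by blast
next
  case (Suc n)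
  let ?s = "s(n := foot (s (Suc n)))"
  have "?s k \<in> stage k" if "k \<ge> n" for k
    using Suc.prems(1)[of k] Suc.prems(1)[of "Suc n"] foot_in_stage that
    by (cases "k = n") auto
  moreover have "foot (?s (Suc k)) = ?s k" if "k \<ge> n" for k
    using Suc.prems(2)[of k] that by (cases "k = n") auto
  ultimately have "\<exists>x\<in>limit. \<forall>k\<ge>n. coord k x = ?s k" by (rule Suc.IH)
  then show ?case by (metis Suc_leD Suc_n_not_le_n fun_upd_apply)
qed

lemma vertex_thread_in_stage:
  assumes "z \<in> stage n" "k \<ge> n" shows "(Vert ^^ (k - n)) z \<in> stage k"
  using assms(2)
proof (induction k rule: dec_induct)
  case (step k)
  then show ?case by (simp add: Suc_diff_le stage_Suc)
qed (use assms in simp)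

lemma vertex_thread_exists:
  assumes "z \<in> stage n"
  shows "\<exists>x\<in>limit. \<forall>k\<ge>n. coord k x = (Vert ^^ (k - n)) z"
  using vertex_thread_in_stage[OF assms] by (intro thread_exists) (auto simp: Suc_diff_le)

lemma coord_surj: "z \<in> stage n \<Longrightarrow> \<exists>x\<in>limit. coord n x = z"
  using vertex_thread_exists[of z n] by fastforce

lemma topspace_limit [simp]: "topspace limit_topology = limit"
proof -
  have "topspace (Metric_space.mtopology (stage n) (stage_dist n)) = stage n" if "n \<ge> 1" for n
    using Metric_space.topspace_mtopology[OF Metric_space_stage, of "n - 1"] that by simp
  then have "Pi\<^sub>E {1..} (\<lambda>n. topspace (Metric_space.mtopology (stage n) (stage_dist n)))
      = Pi\<^sub>E {1..} stage"
    by (intro PiE_cong) auto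
  then show ?thesis by (auto simp: Cob_omega_topology_def Cob_omega_def)
qed

lemma stage_topology:
  "Metric_space.mtopology (stage (Suc n)) (stage_dist (Suc n)) = cob_topology (stage n) (stage_dist n)"
  by (simp add: stage_Suc)

lemma continuous_map_projection:
  "continuous_map limit_topology (cob_topology (stage n) (stage_dist n)) (\<lambda>x. x (Suc n))"
  unfolding Cob_omega_topology_def stage_topology[symmetric]
  by (intro continuous_map_from_subtopology continuous_map_product_projection) auto

lemma continuous_map_coord:
  "continuous_map limit_topology (distance_topology (stage n) (stage_dist n)) (coord n)"
  using continuous_map_compose[OF continuous_map_projection
      continuous_map_foot[OF distance_space_stage]]
  by (simp add: comp_def coord_def[abs_def])

lemma coord_continuous_at:
  assumes "n \<le> k" and x: "x \<in> limit" and "r > 0"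
  shows "\<exists>s>0. \<forall>y\<in>limit. stage_dist k (coord k x) (coord k y) < s
           \<longrightarrow> stage_dist n (coord n x) (coord n y) < r"
  using \<open>n \<le> k\<close>
proof (induction k rule: dec_induct)
  case base
  then show ?case using \<open>r > 0\<close> by blast
next
  case (step k)
  then obtain s where s: "s > 0" "\<forall>y\<in>limit. stage_dist k (coord k x) (coord k y) < s
           \<longrightarrow> stage_dist n (coord n x) (coord n y) < r" by blast
  have "coord (Suc k) x \<in> Cob (stage k) (stage_dist k)"
    using coord_in_stage[OF x] stage_Suc by metis
  from foot_continuous_at[OF distance_space_stage this s(1)] obtain u where u: "u > 0"
    "\<forall>z'\<in>stage (Suc k). stage_dist (Suc k) (coord (Suc k) x) z' < u
       \<longrightarrow> stage_dist k (foot (coord (Suc k) x)) (foot z') < s"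
    unfolding stage_Suc by blast
  then show ?case using s(2) coord_in_stage foot_coord x by metis
qed

text \<open>Because the compression maps are continuous, finitely many coordinates are controlled by a
  single one of larger index, so these one-coordinate neighbourhoods form a basis.\<close>

lemma limit_neighbourhood:
  assumes U: "openin limit_topology U" and x: "x \<in> U"
  obtains k r where "k \<ge> N" "r > 0"
    "\<And>y. \<lbrakk>y \<in> limit; stage_dist k (coord k x) (coord k y) < r\<rbrakk> \<Longrightarrow> y \<in> U"
proof -
  let ?P = "product_topology (\<lambda>n. Metric_space.mtopology (stage n) (stage_dist n)) {1..}"
  obtain W where W: "openin ?P W" "U = W \<inter> limit"
    using U by (auto simp: Cob_omega_topology_def openin_subtopology)
  have xl: "x \<in> limit" using x W by blast
  define F where "F B = {i \<in> {1..}. B i \<noteq> topspace (Metric_space.mtopology (stage i) (stage_dist i))}"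
    for B
  have "x \<in> W" using W x by blast
  with W(1)[unfolded openin_product_topology_alt] obtain B where
    "finite (F B) \<and> (\<forall>i\<in>{1..}. openin (Metric_space.mtopology (stage i) (stage_dist i)) (B i)) \<and>
     x \<in> Pi\<^sub>E {1..} B \<and> Pi\<^sub>E {1..} B \<subseteq> W"
    unfolding F_def by (elim ballE exE) auto
  then have B: "finite (F B)" "x \<in> Pi\<^sub>E {1..} B" "Pi\<^sub>E {1..} B \<subseteq> W"
    "\<And>i. i \<ge> 1 \<Longrightarrow> openin (Metric_space.mtopology (stage i) (stage_dist i)) (B i)"
    by auto
  \<comment> \<open>\<open>F B\<close> is the finite set of coordinates that the basic open set \<open>B\<close> restricts.\<close>
  define k where "k = Max (insert N (F B))"
  have k: "k \<ge> N" "\<And>i. i \<in> F B \<Longrightarrow> i \<le> k" using B(1) by (auto simp: k_def)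
  have "\<forall>\<^sub>F s in at_right 0. \<forall>y\<in>limit. stage_dist k (coord k x) (coord k y) < s \<longrightarrow> y i \<in> B i"
    if i: "i \<in> F B" for i
  proof -
    have i1: "i \<ge> 1" using i by (auto simp: F_def)
    have "Metric_space (stage i) (stage_dist i)" using Metric_space_stage[of "i - 1"] i1 by simp
    then interpret Metric_space "stage i" "stage_dist i" .
    have "x i \<in> B i" using B(2) i1 by auto
    then obtain r where r: "r > 0" "mball (x i) r \<subseteq> B i"
      using B(4)[OF i1] unfolding openin_mtopology by blast
    obtain s where s: "s > 0" "\<forall>y\<in>limit. stage_dist k (coord k x) (coord k y) < s
           \<longrightarrow> stage_dist i (coord i x) (coord i y) < r"
      using coord_continuous_at[OF k(2)[OF i] xl r(1)] by blast
    have "y i \<in> B i" if "y \<in> limit" "stage_dist k (coord k x) (coord k y) < s" for y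
      using that s(2) r(2) coord_in_stage[of _ i] coord_eq[of _ i] i1 xl by auto
    then show ?thesis
      unfolding eventually_at_right_field using s(1) by (intro exI[of _ s]) auto
  qed
  then have "\<forall>\<^sub>F s in at_right 0. \<forall>i\<in>F B. \<forall>y\<in>limit.
      stage_dist k (coord k x) (coord k y) < s \<longrightarrow> y i \<in> B i"
    using B(1) by (simp add: eventually_ball_finite_distrib)
  then obtain c :: real where c: "c > 0" "\<And>s. 0 < s \<Longrightarrow> s < c \<Longrightarrow> \<forall>i\<in>F B. \<forall>y\<in>limit.
      stage_dist k (coord k x) (coord k y) < s \<longrightarrow> y i \<in> B i"
    unfolding eventually_at_right_field by auto
  show thesis
  proof (rule that[of k "c / 2"])
    fix y assume y: "y \<in> limit" "stage_dist k (coord k x) (coord k y) < c / 2"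
    have "y i \<in> B i" if "i \<ge> 1" for i
    proof (cases "i \<in> F B")
      case True
      then show ?thesis using c(2)[of "c / 2"] c(1) y by auto
    next
      case False
      then have "B i = stage i"
        using that Metric_space.topspace_mtopology[OF Metric_space_stage, of "i - 1"]
        by (simp add: F_def)
      then show ?thesis using coord_in_stage[OF y(1)] coord_eq[OF y(1) that] by metis
    qed
    then have "y \<in> Pi\<^sub>E {1..} B" using y(1) by (auto simp: mem_limit PiE_iff)
    then show "y \<in> U" using B(3) W y by blast
  qed (use k c in auto)
qed

section \<open>Complete metrizability of the inverse limit\<close>

lemma completely_metrizable_limit: "completely_metrizable_space limit_topology"
proof -
  let ?M = "\<lambda>n. Metric_space.mtopology (stage n) (stage_dist n)"
  let ?P = "product_topology ?M {1..}"
  have M: "completely_metrizable_space (?M n) \<and> topspace (?M n) = stage n" if "n \<ge> 1" for n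
  proof -
    obtain m where m: "n = Suc m" using \<open>n \<ge> 1\<close> by (cases n) auto
    show ?thesis unfolding m stage_Suc
      using Metric_space.completely_metrizable_space_mtopology[OF Metric_space_Cob mcomplete_Cob]
        Metric_space.topspace_mtopology[OF Metric_space_Cob] by blast
  qed
  then have P: "completely_metrizable_space ?P"
    unfolding completely_metrizable_space_product_topology
    by (auto intro: countable_subset[of _ "UNIV :: nat set"])
  have tP: "topspace ?P = Pi\<^sub>E {1..} stage"
    unfolding topspace_product_topology using M by (intro PiE_cong) auto
  have "closedin ?P {x \<in> topspace ?P. foot (x (Suc n)) = x n}" if "n \<ge> 1" for n
  proof (rule closedin_continuous_maps_eq)
    obtain m where m: "n = Suc m" using \<open>n \<ge> 1\<close> by (cases n) auto
    interpret Metric_space "stage n" "stage_dist n" using Metric_space_stage m by simp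
    show "Hausdorff_space (?M n)" by (rule Hausdorff_space_mtopology)
    show "continuous_map ?P (?M n) (\<lambda>x. x n)"
      using that by (intro continuous_map_product_projection) auto
    have "continuous_map (?M (Suc n)) (?M n) foot"
      using continuous_map_foot[OF distance_space_stage[of n]]
      by (simp only: stage_topology distance_topology_metric[OF Metric_space_axioms])
    moreover have "continuous_map ?P (?M (Suc n)) (\<lambda>x. x (Suc n))"
      by (intro continuous_map_product_projection) auto
    ultimately show "continuous_map ?P (?M n) (\<lambda>x. foot (x (Suc n)))"
      using continuous_map_compose[of ?P "?M (Suc n)" "\<lambda>x. x (Suc n)" "?M n" foot]
      by (simp add: comp_def)
  qed
  then have "closedin ?P (\<Inter>n\<in>{1..}. {x \<in> topspace ?P. foot (x (Suc n)) = x n})"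
    by (intro closedin_INT) auto
  moreover have "limit = (\<Inter>n\<in>{1..}. {x \<in> topspace ?P. foot (x (Suc n)) = x n})"
  proof (rule set_eqI)
    show "x \<in> limit \<longleftrightarrow> x \<in> (\<Inter>n\<in>{1..}. {x \<in> topspace ?P. foot (x (Suc n)) = x n})" for x
      unfolding mem_limit INT_iff mem_Collect_eq tP atLeast_iff Ball_def by (meson order_refl)
  qed
  ultimately show ?thesis
    unfolding Cob_omega_topology_def using completely_metrizable_space_closedin[OF P] by simp
qed

section \<open>Connectedness of the inverse limit\<close>

text \<open>If \<open>z\<close> is a limit of points \<open>b\<close> whose fibres avoid \<open>U\<close>, then the vertex \<open>Vert z\<close> is a
  limit of points in the stars of these \<open>b\<close>, whose fibres are even smaller. Repeating this,
  every coordinate of the thread \<open>z, Vert z, Vert (Vert z), \<dots>\<close> is such a limit, so the thread is not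
  an interior point of \<open>U\<close>.\<close>

lemma vertex_thread_avoids_open:
  assumes U: "openin limit_topology U" and z: "z \<in> stage n"
    and near: "\<And>r. r > 0 \<Longrightarrow>
      \<exists>b\<in>stage n. stage_dist n z b < r \<and> (\<forall>y\<in>limit. coord n y = b \<longrightarrow> y \<notin> U)"
  shows "\<exists>x\<in>limit. coord n x = z \<and> x \<notin> U"
proof -
  obtain x where x: "x \<in> limit" "\<And>k. k \<ge> n \<Longrightarrow> coord k x = (Vert ^^ (k - n)) z"
    using vertex_thread_exists[OF z] by blast
  have near': "\<exists>b\<in>stage k. stage_dist k (coord k x) b < r \<and> (\<forall>y\<in>limit. coord k y = b \<longrightarrow> y \<notin> U)"
    if "k \<ge> n" "r > 0" for k r
    using that(1)
  proof (induction k rule: dec_induct)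
    case base
    then show ?case using near[OF \<open>r > 0\<close>] x(2)[of n] by simp
  next
    case (step k)
    then obtain b where b: "b \<in> stage k" "stage_dist k (coord k x) b < r"
        "\<forall>y\<in>limit. coord k y = b \<longrightarrow> y \<notin> U" by blast
    have "coord (Suc k) x = Vert (coord k x)"
      using x(2) step by (simp add: Suc_diff_le)
    moreover obtain b' where "b' \<in> stage (Suc k)" "foot b' = b"
        "stage_dist (Suc k) (Vert (coord k x)) b' < r"
      using star_approaches_vertex[OF distance_space_stage coord_in_stage[OF x(1)] b(1,2)]
      unfolding stage_Suc by blast
    ultimately show ?case using b(3) foot_coord by metis
  qed
  have "x \<notin> U"
  proof
    assume "x \<in> U"
    then obtain k r where k: "k \<ge> n" "r > 0"
      "\<And>y. \<lbrakk>y \<in> limit; stage_dist k (coord k x) (coord k y) < r\<rbrakk> \<Longrightarrow> y \<in> U"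
      using limit_neighbourhood[OF U] by metis
    then show False using near'[OF k(1,2)] coord_surj by metis
  qed
  then show ?thesis using x by fastforce
qed

text \<open>If the fibre of \<open>z\<close> meets both \<open>U\<close> and \<open>V\<close>, so does the fibre of some point in the star of
  \<open>z\<close>, one stage higher: otherwise this connected star is divided into the points with fibre in \<open>U\<close>
  and those with fibre in \<open>V\<close>, and a point of one part adherent to the other part contradicts the
  previous lemma. Starting in the initial space, one gets a thread none of whose neighbourhoods
  lies in \<open>U\<close> or in \<open>V\<close>.\<close>

lemma fibre_not_divided:
  assumes U: "openin limit_topology U" and V: "openin limit_topology V"
    and cover: "U \<union> V = limit" and disj: "U \<inter> V = {}"
    and "x \<in> U" "y \<in> V"
  shows "coord 0 x \<noteq> coord 0 y"
proof
  assume eq: "coord 0 x = coord 0 y"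
  define D where "D n z \<longleftrightarrow> (\<exists>x\<in>U. coord n x = z) \<and> (\<exists>y\<in>V. coord n y = z)" for n z
  have step: "\<exists>w. D (Suc n) w \<and> foot w = z" if D: "D n z" for n z
  proof (rule ccontr)
    assume none: "\<not> (\<exists>w. D (Suc n) w \<and> foot w = z)"
    let ?S = "cob_topology (stage n) (stage_dist n)" and ?Z = "Zset (stage n) (stage_dist n) z"
    interpret S: Metric_space "stage (Suc n)" "stage_dist (Suc n)" by (rule Metric_space_stage)
    have S: "?S = S.mtopology" by (simp add: stage_Suc)
    have z: "z \<in> stage n" using D cover coord_in_stage by (auto simp: D_def)
    then have Z: "?Z = {w \<in> stage (Suc n). foot w = z}" by (simp add: Zset_eq stage_Suc)
    define A where "A U = {w \<in> ?Z. \<forall>x\<in>limit. coord (Suc n) x = w \<longrightarrow> x \<in> U}" for U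
    have adherent: "A U' \<inter> S.mtopology closure_of A V' = {}"
      if "openin limit_topology U'" "U' \<inter> V' = {}" for U' V'
    proof (rule ccontr)
      assume "A U' \<inter> S.mtopology closure_of A V' \<noteq> {}"
      then obtain w where w: "w \<in> A U'" "\<And>r. r > 0 \<Longrightarrow> \<exists>b\<in>A V'. b \<in> S.mball w r"
        unfolding S.metric_closure_of by blast
      have "\<exists>b\<in>stage (Suc n). stage_dist (Suc n) w b < r \<and>
          (\<forall>y\<in>limit. coord (Suc n) y = b \<longrightarrow> y \<notin> U')" if r: "r > 0" for r
      proof -
        obtain b where "b \<in> A V'" "b \<in> S.mball w r" using w(2)[OF r] by blast
        then show ?thesis using \<open>U' \<inter> V' = {}\<close> by (auto simp: A_def)
      qed
      then have "\<exists>x\<in>limit. coord (Suc n) x = w \<and> x \<notin> U'"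
        using w(1) Z by (intro vertex_thread_avoids_open[OF that(1)]) (auto simp: A_def)
      then show False using w(1) by (auto simp: A_def)
    qed
    have inA: "coord (Suc n) x \<in> A U'"
      if "x \<in> U'" "coord n x = z" "U' = U \<and> V' = V \<or> U' = V \<and> V' = U" for x U' V'
    proof -
      have "x \<in> limit" using that cover by blast
      then have "coord (Suc n) x \<in> ?Z" using Z coord_in_stage foot_coord that(2) by auto
      then show ?thesis using none that(1,3) cover Z unfolding A_def D_def by blast
    qed
    have "A U \<noteq> {}" using D inA[of _ U V] by (fastforce simp: D_def)
    moreover have "A V \<noteq> {}" using D inA[of _ V U] by (fastforce simp: D_def)
    moreover have "A U \<union> A V = ?Z"
      using none cover Z unfolding A_def D_def by blast
    moreover have "connectedin S.mtopology ?Z" using connectedin_Zset[OF z] S by metis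
    ultimately show False
      using adherent[OF U disj] adherent[OF V, of U] disj unfolding connectedin_separation
      by (metis Int_commute)
  qed
  have "\<exists>z. D 0 z" using assms(5,6) eq by (auto simp: D_def)
  then obtain f where f: "\<And>n. D n (f n)" "\<And>n. foot (f (Suc n)) = f n"
    using dependent_nat_choice[of D "\<lambda>n z w. foot w = z"] step by metis
  have fin: "f n \<in> stage n" for n
  proof -
    obtain x where "x \<in> U" "coord n x = f n" using f(1)[of n] unfolding D_def by blast
    then show ?thesis using cover coord_in_stage[of x n] by auto
  qed
  then obtain t where t: "t \<in> limit" "\<And>k. coord k t = f k"
    using thread_exists[of 0 f] f(2) by blast
  have swallowed: "\<exists>k. \<forall>y\<in>limit. coord k y = f k \<longrightarrow> y \<in> W" if W: "openin limit_topology W" "t \<in> W" for W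
  proof -
    obtain k r where "r > 0" and
      kr: "\<And>y. \<lbrakk>y \<in> limit; stage_dist k (coord k t) (coord k y) < r\<rbrakk> \<Longrightarrow> y \<in> W"
      using limit_neighbourhood[OF W, of 0] by metis
    have "y \<in> W" if "y \<in> limit" "coord k y = f k" for y
      using kr[of y] that t(2)[of k] \<open>r > 0\<close>
        distance_space.refl_zero[OF distance_space_stage fin[of k]] by simp
    then show ?thesis by blast
  qed
  show False
  proof (cases "t \<in> U")
    case True
    then obtain k where k: "\<forall>y\<in>limit. coord k y = f k \<longrightarrow> y \<in> U" using swallowed[OF U] by blast
    obtain y where "y \<in> V" "coord k y = f k" using f(1)[of k] unfolding D_def by blast
    then show False using k cover disj by blast
  next
    case False
    then have "t \<in> V" using t(1) cover by blast
    then obtain k where k: "\<forall>y\<in>limit. coord k y = f k \<longrightarrow> y \<in> V" using swallowed[OF V] by blast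
    obtain x where "x \<in> U" "coord k x = f k" using f(1)[of k] unfolding D_def by blast
    then show False using k cover disj by blast
  qed
qed

text \<open>The points of the initial space whose fibre lies in \<open>U\<close> form a distance-open set: a point that is
  a limit of points with fibre in \<open>V\<close> has a vertex thread outside \<open>U\<close>.\<close>

lemma connected_limit:
  assumes "connected_space (distance_topology (stage 0) (stage_dist 0))"
  shows "connected_space limit_topology"
  unfolding connected_space_def topspace_limit
proof (rule notI, elim exE conjE)
  fix U V
  assume UV: "openin limit_topology U" "openin limit_topology V" "limit \<subseteq> U \<union> V" "U \<inter> V = {}"
    and ne: "U \<noteq> {}" "V \<noteq> {}"
  have cover: "U \<union> V = limit" using UV openin_subset by fastforce
  define A where "A U = {z \<in> stage 0. \<forall>x\<in>limit. coord 0 x = z \<longrightarrow> x \<in> U}" for U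
  have A_cover: "A U \<union> A V = stage 0"
    using fibre_not_divided[OF UV(1,2) cover UV(4)] cover unfolding A_def by blast
  have "openin (distance_topology (stage 0) (stage_dist 0)) (A U')"
    if "openin limit_topology U'" "U' = U \<and> V' = V \<or> U' = V \<and> V' = U" for U' V'
    unfolding openin_distance_topology distance_open_def
  proof (intro conjI ballI)
    fix z assume z: "z \<in> A U'"
    show "\<exists>r>0. dball (stage 0) (stage_dist 0) z r \<subseteq> A U'"
    proof (rule ccontr)
      assume no: "\<not> ?thesis"
      have "\<exists>b\<in>stage 0. stage_dist 0 z b < r \<and> (\<forall>y\<in>limit. coord 0 y = b \<longrightarrow> y \<notin> U')"
        if r: "r > 0" for r
      proof -
        obtain b where "b \<in> stage 0" "stage_dist 0 z b < r" "b \<notin> A U'"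
          using no r unfolding dball_def by blast
        moreover from this have "b \<in> A V'"
          using A_cover \<open>U' = U \<and> V' = V \<or> U' = V \<and> V' = U\<close> by blast
        ultimately show ?thesis using UV(4) \<open>U' = U \<and> V' = V \<or> U' = V \<and> V' = U\<close>
          unfolding A_def by blast
      qed
      then have "\<exists>x\<in>limit. coord 0 x = z \<and> x \<notin> U'"
        using z by (intro vertex_thread_avoids_open[OF that(1)]) (auto simp: A_def)
      then show False using z by (auto simp: A_def)
    qed
  qed (auto simp: A_def)
  then have "openin (distance_topology (stage 0) (stage_dist 0)) (A U)"
    "openin (distance_topology (stage 0) (stage_dist 0)) (A V)" using UV by blast+
  moreover have "A U \<inter> A V = {}" using coord_surj[of _ 0] UV(4) by (auto simp: A_def)
  moreover have "A U \<noteq> {}" "A V \<noteq> {}"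
    using ne A_cover fibre_not_divided[OF UV(1,2) cover UV(4)] cover coord_in_stage[of _ 0]
    unfolding A_def by blast+
  ultimately show False
    using assms A_cover unfolding connected_space_def by (metis order_refl topspace_distance_topology)
qed

lemma connected_stage_0:
  assumes "connected_space limit_topology"
  shows "connected_space (distance_topology (stage 0) (stage_dist 0))"
proof -
  have "coord 0 ` limit = stage 0" using coord_surj[of _ 0] coord_in_stage[of _ 0] by blast
  then show ?thesis
    using connectedin_continuous_map_image[OF continuous_map_coord[of 0], of limit] assms
      connectedin_topspace[of limit_topology]
      connectedin_topspace[of "distance_topology (stage 0) (stage_dist 0)"] by simp
qed

section \<open>Separable connected subsets of the inverse limit\<close>

text \<open>The coordinate \<open>n\<close> is the foot of the coordinate \<open>n + 1\<close>, which lies in a cobweb over a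
  metric space as soon as \<open>n \<ge> 1\<close>.\<close>

lemma separable_connected_limit_singleton:
  assumes conn: "connectedin limit_topology S" and sep: "separable_space (subtopology limit_topology S)"
    and xy: "x \<in> S" "y \<in> S"
  shows "x = y"
proof -
  have S: "S \<subseteq> limit" using connectedin_subset_topspace[OF conn] by simp
  have "x n = y n" if "n \<ge> 1" for n
  proof -
    let ?p = "\<lambda>x. x (Suc n)" and ?S = "cob_topology (stage n) (stage_dist n)"
    have c: "connectedin ?S (?p ` S)"
      using connectedin_continuous_map_image[OF continuous_map_projection conn] .
    have "continuous_map (subtopology limit_topology S) (subtopology ?S (?p ` S)) ?p"
      using continuous_map_projection
      by (intro continuous_map_into_subtopology continuous_map_from_subtopology) auto
    then have "separable_space (subtopology ?S (?p ` S))"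
      using sep S connectedin_subset_topspace[OF c]
      by (elim separable_space_continuous_map_image[rotated]) (auto simp: Int_absorb1)
    moreover have "Metric_space (stage n) (stage_dist n)"
      using Metric_space_stage[of "n - 1"] that by simp
    ultimately have "coord n x = coord n y"
      unfolding coord_def using foot_constant_on_separable_connected[OF _ c] xy by blast
    then show ?thesis using coord_eq xy S that by (metis subsetD)
  qed
  moreover have "x \<in> Pi\<^sub>E {1..} stage" "y \<in> Pi\<^sub>E {1..} stage"
    using S xy mem_limit by blast+
  ultimately show ?thesis by (intro PiE_ext[of x "{1..}" stage y]) auto
qed

end

lemma continuous_map_distance_topology:
  assumes "f ` X \<subseteq> Y" "\<And>x y. \<lbrakk>x \<in> X; y \<in> X\<rbrakk> \<Longrightarrow> e (f x) (f y) \<le> d x y"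
  shows "continuous_map (distance_topology X d) (distance_topology Y e) f"
  unfolding continuous_map
proof (intro conjI allI impI)
  fix U assume U: "openin (distance_topology Y e) U"
  show "openin (distance_topology X d) {x \<in> topspace (distance_topology X d). f x \<in> U}"
    unfolding openin_distance_topology distance_open_def
  proof (intro conjI ballI)
    fix x assume "x \<in> {x \<in> topspace (distance_topology X d). f x \<in> U}"
    then have x: "x \<in> X" "f x \<in> U" by auto
    then obtain r where "r > 0" "dball Y e (f x) r \<subseteq> U"
      using U unfolding openin_distance_topology distance_open_def by blast
    moreover have "f y \<in> dball Y e (f x) r" if "y \<in> dball X d x r" for y
      using assms(1) assms(2)[of x y] that x by (auto simp: dball_def)
    ultimately show "\<exists>r>0. dball X d x r \<subseteq> {x \<in> topspace (distance_topology X d). f x \<in> U}"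
      by (intro exI[of _ r]) (auto simp: dball_def)
  qed auto
qed (use assms in auto)

section \<open>The topology of the iterated cobweb limit\<close>

theorem theorem3p2:
  fixes X :: "'a set" and d :: "'a \<Rightarrow> 'a \<Rightarrow> real"
  assumes "distance_space X d"
  shows "completely_metrizable_space (Cob_omega_topology X d) \<and>
         (connected_space (Cob_omega_topology X d) \<longleftrightarrow> connected_space (distance_topology X d)) \<and>
         (\<forall>x \<in> topspace (Cob_omega_topology X d).
            separablewise_component_of (Cob_omega_topology X d) x = {x})"
proof -
  interpret distance_space X d by fact
  let ?X0 = "distance_topology (stage 0) (stage_dist 0)"
  have "continuous_map (distance_topology X d) ?X0 Base"
       "continuous_map ?X0 (distance_topology X d) of_Base"
    by (auto intro!: continuous_map_distance_topology simp: stage_0)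
  then have "distance_topology X d homeomorphic_space ?X0"
    unfolding homeomorphic_space_def homeomorphic_maps_def
    by (intro exI[of _ Base] exI[of _ of_Base]) (auto simp: stage_0)
  then have base: "connected_space (distance_topology X d) \<longleftrightarrow> connected_space ?X0"
    by (rule homeomorphic_connected_space)
  have "separablewise_component_of limit_topology x = {x}" if x: "x \<in> limit" for x
  proof -
    have "separable_space (subtopology limit_topology {x})"
      using x closure_of_topspace[of "subtopology limit_topology {x}"]
      unfolding separable_space_def by (intro exI[of _ "{x}"]) simp
    then have "x \<in> separablewise_component_of limit_topology x"
      using x unfolding separablewise_component_of_def
      by (intro UnionI[of "{x}"]) auto
    moreover have "y = x" if "y \<in> separablewise_component_of limit_topology x" for y
      using that separable_connected_limit_singleton
      by (auto simp: separablewise_component_of_def)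
    ultimately show ?thesis by blast
  qed
  then show ?thesis
    using completely_metrizable_limit connected_limit connected_stage_0 base by auto
qed

end
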